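(* Let $X\subset\{0,1\}^{\mathbb{N}}$ be the shift space $X=\overline{\bigcup_{n\ge0}X_n}$ defined in the context. Then $(X,\sigma)$ is not $\omega^*$-chaotic.
   Context: For a dynamical system $(X,T)$ ($X$ compact metric, $T\colon X\to X$ continuous), $\omega_T(x)$ is the set of limit points of the sequence $(T^n(x))_{n\in\mathbb{N}}$. A set $M\subset X$ is minimal if it is nonempty, closed, invariant and contains no proper subset with these properties. $(X,T)$ is $\omega^*$-chaotic if there exists an uncountable set $S\subset X$ such that for any $x,y\in S$ with $x\ne y$: $\omega_T(x)\setminus\omega_T(y)$ contains an infinite minimal set, and $\omega_T(x)\cap\omega_T(y)$ is nonempty. $\mathbb{N}=\{1,2,\dots\}$; $\{0,1\}^{\mathbb{N}}$ carries the product topology and $\sigma$ is the shift map, $\sigma(x)_i=x_{i+1}$. A shift space is a closed $\sigma$-invariant subset. For blocks, $u^\infty=uuu\dots$, $0^\alpha$ is the block of $\alpha$ zeros ($0^0$ is the empty block), and $\|u\|_1$ is the number of $1$'s in $u$. A block is a from-$1$-to-$1$ word if it equals $1$ or has the form $1v1$ with $v\in\{0,1\}^*$ (possibly empty). For a shift space $Y\subset\{0,1\}^{\mathbb{N}}$, $\mathcal{G}_m(Y)$ is the set of all from-$1$-to-$1$ words $u$ that occur in some point of $Y$ and satisfy $\|u\|_1\le m$. Construction of $X$: let $X_0=\{0^\infty\}\cup\{0^\alpha10^\infty:\alpha\ge0\}$. Given $X_n$ ($n\ge0$), let $$P_{n+1}=\bigcup_{l=0}^\infty\sigma^l\big(\{(u0^k)^\infty:k\ge2^{2n},\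 u\in\mathcal{G}_{2^n}(X_n)\}\big),$$ $$J'_{n+1}=\{0^\alpha u0^\infty:\alpha\ge0,\ u\in\mathcal{G}_{2^n}(X_n)\},$$ $$J''_{n+1}=\{0^\alpha u0^\beta v0^\infty:\alpha\ge0,\ \beta\ge2^{2n},\ u,v\in\mathcal{G}_{2^n}(X_n)\},$$ $J_{n+1}=J'_{n+1}\cup J''_{n+1}$, $Y_{n+1}=\overline{P_{n+1}\cup J_{n+1}}$, and $X_{n+1}=X_n\cup Y_{n+1}$. Finally $X=\overline{\bigcup_{n=0}^\infty X_n}$. *)

theory Defs
  imports "HOL-Analysis.Analysis" "HOL-Library.Omega_Words_Fun"
begin

text \<open>
  All notions are relative to a set \<open>X\<close> and a map \<open>T\<close> that is meant to be continuous on \<open>X\<close>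
  and to map \<open>X\<close> into itself; only the values of \<open>T\<close> on \<open>X\<close> matter.
\<close>

text \<open>
  Limit points of the \<^emph>\<open>sequence\<close> of iterates, not accumulation points of the orbit as a set:
  a periodic orbit is its own limit set.
\<close>

definition omega_limit :: "('a::topological_space \<Rightarrow> 'a) \<Rightarrow> 'a \<Rightarrow> 'a set" where
  "omega_limit T x =
     {y. \<exists>r::nat \<Rightarrow> nat. strict_mono r \<and> (\<lambda>k. (T ^^ r k) x) \<longlonglongrightarrow> y}"

definition closed_invariant :: "'a::topological_space set \<Rightarrow> ('a \<Rightarrow> 'a) \<Rightarrow> 'a set \<Rightarrow> bool" where
  "closed_invariant X T M \<longleftrightarrow> M \<noteq> {} \<and> closedin (top_of_set X) M \<and> T ` M \<subseteq> M"

definition minimal_set :: "'a::topological_space set \<Rightarrow> ('a \<Rightarrow> 'a) \<Rightarrow> 'a set \<Rightarrow> bool" where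
  "minimal_set X T M \<longleftrightarrow>
     closed_invariant X T M \<and> (\<forall>N. N \<subset> M \<longrightarrow> \<not> closed_invariant X T N)"

definition omega_star_chaotic :: "'a::topological_space set \<Rightarrow> ('a \<Rightarrow> 'a) \<Rightarrow> bool" where
  "omega_star_chaotic X T \<longleftrightarrow>
     (\<exists>S. S \<subseteq> X \<and> uncountable S \<and>
        (\<forall>x\<in>S. \<forall>y\<in>S. x \<noteq> y \<longrightarrow>
           (\<exists>M. minimal_set X T M \<and> infinite M \<and> M \<subseteq> omega_limit T x - omega_limit T y) \<and>
           omega_limit T x \<inter> omega_limit T y \<noteq> {}))"

text \<open>
  The symbols 0 and 1 are \<^const>\<open>False\<close> and \<^const>\<open>True\<close>, so \<open>{0,1}\<^sup>\<nat>\<close> is the type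
  \<^typ>\<open>bool word\<close>, that is \<^typ>\<open>nat \<Rightarrow> bool\<close>, whose topology is the product of the discrete
  topologies. Indices start at 0 instead of 1. Blocks are lists; \<open>u \<frown> x\<close> is the block \<open>u\<close>
  followed by the sequence \<open>x\<close>, and \<open>u\<^sup>\<omega> = uuu\<dots>\<close>.
\<close>

definition shift :: "bool word \<Rightarrow> bool word" (\<open>\<sigma>\<close>) where
  "\<sigma> x = (\<lambda>i. x (Suc i))"

definition zeros :: "nat \<Rightarrow> bool list" where
  "zeros k = replicate k False"

definition zero_seq :: "bool word" where
  "zero_seq = [False]\<^sup>\<omega>"

definition num_ones :: "bool list \<Rightarrow> nat" where
  "num_ones u = count_list u True"

definition from_1_to_1 :: "bool list \<Rightarrow> bool" where
  "from_1_to_1 u \<longleftrightarrow> u = [True] \<or> (\<exists>v. u = [True] @ v @ [True])"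

definition occurs_in :: "bool list \<Rightarrow> bool word \<Rightarrow> bool" where
  "occurs_in u x \<longleftrightarrow> (\<exists>i j. u = subsequence x i j)"

definition G :: "nat \<Rightarrow> bool word set \<Rightarrow> bool list set" where
  "G m Y = {u. from_1_to_1 u \<and> (\<exists>x\<in>Y. occurs_in u x) \<and> num_ones u \<le> m}"

text \<open>
  The sets \<open>P\<close>, \<open>J'\<close>, \<open>J''\<close> and \<open>Y\<close> of level \<open>n + 1\<close> are functions of \<open>n\<close> and of the
  set \<open>X\<^sub>n\<close> of level \<open>n\<close>.
\<close>

definition P_next :: "nat \<Rightarrow> bool word set \<Rightarrow> bool word set" where
  "P_next n Xn =
     (\<Union>l. (\<sigma> ^^ l) ` {(u @ zeros k)\<^sup>\<omega> | u k. k \<ge> 2 ^ (2 * n) \<and> u \<in> G (2 ^ n) Xn})"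

definition J1_next :: "nat \<Rightarrow> bool word set \<Rightarrow> bool word set" where
  "J1_next n Xn = {zeros a \<frown> u \<frown> zero_seq | a u. u \<in> G (2 ^ n) Xn}"

definition J2_next :: "nat \<Rightarrow> bool word set \<Rightarrow> bool word set" where
  "J2_next n Xn =
     {zeros a \<frown> u \<frown> zeros b \<frown> v \<frown> zero_seq | a u b v.
        b \<ge> 2 ^ (2 * n) \<and> u \<in> G (2 ^ n) Xn \<and> v \<in> G (2 ^ n) Xn}"

definition Y_next :: "nat \<Rightarrow> bool word set \<Rightarrow> bool word set" where
  "Y_next n Xn = closure (P_next n Xn \<union> (J1_next n Xn \<union> J2_next n Xn))"

primrec X_level :: "nat \<Rightarrow> bool word set" where
  "X_level 0 = {zero_seq} \<union> {zeros a \<frown> [True] \<frown> zero_seq | a. True}"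
| "X_level (Suc n) = X_level n \<union> Y_next n (X_level n)"

definition X_space :: "bool word set" where
  "X_space = closure (\<Union>n. X_level n)"

lemma continuous_shift: "continuous_on A \<sigma>"
  unfolding shift_def
  by (rule continuous_on_coordinatewise_then_product)
     (auto intro: continuous_on_product_coordinates continuous_on_subset)

lemma compact_bool_words: "compact (UNIV :: bool word set)"
proof -
  have "compactin (product_topology (\<lambda>_::nat. euclidean :: bool topology) UNIV) (Pi\<^sub>E UNIV (\<lambda>_. UNIV))"
    by (subst compactin_PiE) (auto simp: finite_imp_compact)
  then show ?thesis
    by (simp add: euclidean_product_topology PiE_UNIV_domain)
qed

lemma compact_X_space: "compact X_space"
  using closed_Int_compact[of X_space UNIV] compact_bool_words
  by (simp add: X_space_def)

lemma shift_zero_seq: "\<sigma> zero_seq = zero_seq"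
  by (auto simp: zero_seq_def shift_def)

lemma closed_zero_seq: "closed {zero_seq}"
proof -
  have "closed {x :: bool word. x i = zero_seq i}" for i
    by (intro closed_Collect_eq continuous_on_product_coordinates continuous_on_const)
  then have "closed (\<Inter>i. {x. x i = zero_seq i})" by blast
  also have "(\<Inter>i. {x. x i = zero_seq i}) = {zero_seq}" by (auto simp: fun_eq_iff)
  finally show ?thesis .
qed

lemma shift_Cons: "\<sigma> ((c # u) \<frown> x) = u \<frown> x"
  by (auto simp: conc_def fun_eq_iff shift_def)

lemma shift_build: "\<sigma> (c ## x) = x"
  by (simp add: shift_def fun_eq_iff)

lemma shift_zeros_Suc: "\<sigma> (zeros (Suc a) \<frown> x) = zeros a \<frown> x"
  by (simp only: zeros_def replicate_Suc shift_Cons)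

lemma G_tail:
  assumes "u \<in> G m Y" "u \<noteq> [True]"
  obtains a u' where "u = True # zeros a @ u'" "u' \<in> G m Y"
proof -
  from assms(1) have f1: "from_1_to_1 u" and m: "num_ones u \<le> m"
    and "\<exists>x\<in>Y. occurs_in u x"
    unfolding G_def by blast+
  then obtain x i j where x: "x \<in> Y" and ij: "u = subsequence x i j"
    unfolding occurs_in_def by blast
  from f1 assms(2) obtain v where v: "u = True # v @ [True]"
    unfolding from_1_to_1_def by auto
  define u' where "u' = dropWhile Not (v @ [True])"
  define a where "a = length (takeWhile Not (v @ [True]))"
  have "takeWhile Not (v @ [True]) = zeros a"
    unfolding zeros_def a_def by (rule replicate_eqI[symmetric, THEN sym]) (auto dest: set_takeWhileD)
  then have split: "v @ [True] = zeros a @ u'"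
    using takeWhile_dropWhile_id[of Not "v @ [True]"] by (simp add: u'_def)
  have ne: "u' \<noteq> []" by (auto simp: u'_def dropWhile_eq_Nil_conv)
  have hd: "hd u' = True"
    using hd_dropWhile[of Not "v @ [True]"] ne by (simp add: u'_def)
  have last: "last u' = True"
    using arg_cong[OF split, of last] ne by simp
  have f: "from_1_to_1 u'"
  proof (cases "tl u' = []")
    case True
    then have "u' = [True]" using ne hd by (cases u') auto
    then show ?thesis by (simp add: from_1_to_1_def)
  next
    case False
    then have "u' = [True] @ butlast (tl u') @ [True]"
      using ne hd last append_butlast_last_id[OF False] by (cases u') auto
    then show ?thesis unfolding from_1_to_1_def by blast
  qed
  have u: "u = True # zeros a @ u'" using v split by simp
  then have "u' = drop (Suc a) u" by (simp add: zeros_def)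
  then have "u' = subsequence x (i + Suc a) j" using ij by simp
  moreover have "num_ones u' \<le> m" using m u by (simp add: num_ones_def)
  ultimately have "u' \<in> G m Y"
    using f x unfolding G_def occurs_in_def by blast
  then show thesis using u that by blast
qed

lemma zero_seq_in_X_level: "zero_seq \<in> X_level n"
  by (induction n) auto

lemma shift_J1_next: "\<sigma> ` J1_next n Xn \<subseteq> insert zero_seq (J1_next n Xn)"
proof
  fix y assume "y \<in> \<sigma> ` J1_next n Xn"
  then obtain a u where y: "y = \<sigma> (zeros a \<frown> u \<frown> zero_seq)" and u: "u \<in> G (2 ^ n) Xn"
    by (auto simp: J1_next_def simp del: conc_conc)
  show "y \<in> insert zero_seq (J1_next n Xn)"
  proof (cases a)
    case (Suc a')
    then show ?thesis
      using y u shift_zeros_Suc unfolding J1_next_def by blast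
  next
    case 0
    then have y0: "y = \<sigma> (u \<frown> zero_seq)" using y by (simp add: zeros_def)
    show ?thesis
    proof (cases "u = [True]")
      case True
      then show ?thesis using y0 by (simp add: shift_Cons shift_build)
    next
      case False
      then obtain b u' where "u = True # zeros b @ u'" "u' \<in> G (2 ^ n) Xn"
        using G_tail[OF u] by blast
      moreover from this have "y = zeros b \<frown> u' \<frown> zero_seq"
        using y0 by (simp add: shift_Cons shift_build)
      ultimately show ?thesis unfolding J1_next_def by blast
    qed
  qed
qed

lemma shift_J2_next: "\<sigma> ` J2_next n Xn \<subseteq> J1_next n Xn \<union> J2_next n Xn"
proof
  fix y assume "y \<in> \<sigma> ` J2_next n Xn"
  then obtain a u b v where y: "y = \<sigma> (zeros a \<frown> u \<frown> zeros b \<frown> v \<frown> zero_seq)"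
    and u: "u \<in> G (2 ^ n) Xn" and v: "v \<in> G (2 ^ n) Xn" and b: "b \<ge> 2 ^ (2 * n)"
    by (auto simp: J2_next_def simp del: conc_conc)
  show "y \<in> J1_next n Xn \<union> J2_next n Xn"
  proof (cases a)
    case (Suc a')
    then have "y = zeros a' \<frown> u \<frown> zeros b \<frown> v \<frown> zero_seq"
      using y shift_zeros_Suc by blast
    then show ?thesis
      using u v b unfolding J2_next_def by blast
  next
    case 0
    then have y0: "y = \<sigma> (u \<frown> zeros b \<frown> v \<frown> zero_seq)" using y by (simp add: zeros_def)
    show ?thesis
    proof (cases "u = [True]")
      case True
      then have "y = zeros b \<frown> v \<frown> zero_seq" using y0 by (simp add: shift_Cons shift_build)
      then show ?thesis using v unfolding J1_next_def by blast
    next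
      case False
      then obtain c u' where *: "u = True # zeros c @ u'" "u' \<in> G (2 ^ n) Xn"
        using G_tail[OF u] by blast
      then have "y = zeros c \<frown> u' \<frown> zeros b \<frown> v \<frown> zero_seq"
        using y0 by (simp add: shift_Cons shift_build)
      then show ?thesis using * v b unfolding J2_next_def by blast
    qed
  qed
qed

lemma shift_P_next: "\<sigma> ` P_next n Xn \<subseteq> P_next n Xn"
proof
  fix y assume "y \<in> \<sigma> ` P_next n Xn"
  then obtain l x where "y = (\<sigma> ^^ Suc l) x"
    and "x \<in> {(u @ zeros k)\<^sup>\<omega> | u k. k \<ge> 2 ^ (2 * n) \<and> u \<in> G (2 ^ n) Xn}"
    unfolding P_next_def by auto
  then show "y \<in> P_next n Xn" unfolding P_next_def by blast
qed

lemma shift_closure: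
  assumes "\<sigma> ` A \<subseteq> closure B"
  shows "\<sigma> ` closure A \<subseteq> closure B"
  by (rule image_closure_subset[OF continuous_shift closed_closure assms])

lemma shift_X_level: "\<sigma> ` X_level n \<subseteq> X_level n"
proof (induction n)
  case 0
  have "\<sigma> (zeros a \<frown> [True] \<frown> zero_seq) \<in> X_level 0" for a
  proof (cases a)
    case 0
    then show ?thesis by (simp add: zeros_def shift_Cons shift_build)
  next
    case (Suc a')
    then have "\<sigma> (zeros a \<frown> [True] \<frown> zero_seq) = zeros a' \<frown> [True] \<frown> zero_seq"
      using shift_zeros_Suc by blast
    then show ?thesis unfolding X_level.simps by blast
  qed
  then show ?case
    using shift_zero_seq by (auto simp del: conc_conc)
next
  case (Suc n)
  let ?A = "P_next n (X_level n) \<union> (J1_next n (X_level n) \<union> J2_next n (X_level n))"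
  have "\<sigma> ` ?A \<subseteq> insert zero_seq ?A"
    using shift_P_next[of n "X_level n"] shift_J1_next[of n "X_level n"]
      shift_J2_next[of n "X_level n"] by (simp only: image_Un) blast
  then have "\<sigma> ` closure ?A \<subseteq> closure (insert zero_seq ?A)"
    by (intro shift_closure) (meson closure_subset subset_trans)
  also have "\<dots> = insert zero_seq (closure ?A)"
    unfolding insert_is_Un[of _ ?A] closure_Un[of "{zero_seq}"]
    using closed_zero_seq by (simp only: closure_closed insert_is_Un[symmetric])
  finally show ?case
    using Suc zero_seq_in_X_level[of n] by (auto simp: Y_next_def)
qed

lemma shift_X_space: "\<sigma> ` X_space \<subseteq> X_space"
  unfolding X_space_def
proof (rule shift_closure)
  have "\<sigma> ` (\<Union>n. X_level n) \<subseteq> (\<Union>n. X_level n)" using shift_X_level by blast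
  then show "\<sigma> ` (\<Union>n. X_level n) \<subseteq> closure (\<Union>n. X_level n)"
    by (meson closure_subset subset_trans)
qed

end

theory Submission
  imports Defs
begin

text \<open>
  A minimal subset \<open>M\<close> of \<open>X\<close> other than the fixed point \<open>0\<^sup>\<infinity>\<close> has bounded gaps: by compactness
  there is \<open>K\<close> such that every window of length \<open>K\<close> of every point of \<open>M\<close> contains a 1. A word
  from 1 to 1 with such gaps cannot cross the runs of at least \<open>2\<^sup>2\<^sup>n\<close> zeros inserted in passing from
  \<open>X\<^sub>n\<close> to \<open>X\<^sub>n\<^sub>+\<^sub>1\<close> if \<open>n \<ge> K\<close>, so it occurs in \<open>X\<^sub>K\<close>. There it is either a subword of a periodic point
  of small period, or it contains at most \<open>2\<^sup>K\<close> ones and is therefore short. Hence all points of \<open>M\<close>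
  are eventually periodic with a common period, and \<open>M\<close> is a periodic orbit. So \<open>X\<close> has no infinite
  minimal set at all.
\<close>

section \<open>Tameness as a local property\<close>

definition gaps_below :: "nat \<Rightarrow> bool word \<Rightarrow> nat \<Rightarrow> nat \<Rightarrow> bool" where
  "gaps_below K x i m \<longleftrightarrow> (\<forall>r. i \<le> r \<longrightarrow> r + K \<le> i + m \<longrightarrow> (\<exists>s\<in>{r..<r + K}. x s))"

text \<open>
  The bound \<open>K * (2 ^ K + 1)\<close> is chosen so that a window of this length with gaps below \<open>K\<close> has
  more than \<open>2 ^ K\<close> ones; its factorial is a common multiple of all periods up to the bound.
\<close>

definition tame :: "nat \<Rightarrow> bool word \<Rightarrow> bool" where
  "tame K x \<longleftrightarrow>
     (\<forall>i m. x i \<longrightarrow> x (i + m) \<longrightarrow> gaps_below K x i m \<longrightarrow>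
        m < K * (2 ^ K + 1) \<or>
        (\<forall>r. r + fact (K * (2 ^ K + 1)) \<le> m \<longrightarrow> x (i + r + fact (K * (2 ^ K + 1))) = x (i + r)))"

lemma gaps_below_cong:
  assumes "\<And>r. r \<le> m \<Longrightarrow> y (j + r) = x (i + r)" "gaps_below K x i m"
  shows "gaps_below K y j m"
  unfolding gaps_below_def
proof (intro allI impI)
  fix r assume r: "j \<le> r" "r + K \<le> j + m"
  then have "i \<le> i + (r - j)" "i + (r - j) + K \<le> i + m" by auto
  then obtain s where s: "i + (r - j) \<le> s" "s < i + (r - j) + K" "x s"
    using assms(2) unfolding gaps_below_def by (meson atLeastLessThan_iff)
  have "y (j + (s - i)) = x (i + (s - i))" using s r by (intro assms(1)) auto
  then show "\<exists>s\<in>{r..<r + K}. y s" using s r by (intro bexI[of _ "j + (s - i)"]) auto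
qed

text \<open>For fixed \<open>i\<close> and \<open>m\<close>, tameness inspects only the coordinates
  from \<open>i\<close> to \<open>i + m\<close>. A tame \<open>y\<close> that agrees with
  \<open>x\<close> along this one window, possibly at another position \<open>j\<close>, therefore
  decides it. This serves both closures and blocks copied from a lower level.\<close>

lemma tame_window:
  assumes "tame K y" "\<And>r. r \<le> m \<Longrightarrow> y (j + r) = x (i + r)"
    and "x i" "x (i + m)" "gaps_below K x i m"
  shows "m < K * (2 ^ K + 1) \<or>
    (\<forall>r. r + fact (K * (2 ^ K + 1)) \<le> m \<longrightarrow> x (i + r + fact (K * (2 ^ K + 1))) = x (i + r))"
proof -
  let ?L = "fact (K * (2 ^ K + 1))"
  have "y j" "y (j + m)" using assms(2)[of 0] assms(2)[of m] assms(3,4) by auto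
  moreover have "gaps_below K y j m" using gaps_below_cong[of m y j x i K] assms by blast
  ultimately have *: "m < K * (2 ^ K + 1) \<or> (\<forall>r. r + ?L \<le> m \<longrightarrow> y (j + r + ?L) = y (j + r))"
    using assms(1) unfolding tame_def by blast
  have "x (i + r + ?L) = x (i + r)" if "r + ?L \<le> m" "y (j + r + ?L) = y (j + r)" for r
    using assms(2)[of r] assms(2)[of "r + ?L"] that by (simp add: add.assoc)
  then show ?thesis using * by blast
qed

section \<open>Tameness passes to closures\<close>

lemma open_coordinate: "open {y :: bool word. y t = c}"
proof -
  have "{y :: bool word. y t = c} = (\<lambda>y. y t) -` {c}" by auto
  moreover have "open ((\<lambda>y :: bool word. y t) -` {c})"
    by (intro open_vimage open_discrete continuous_on_product_coordinates)
  ultimately show ?thesis by simp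
qed

lemma closure_prefix:
  fixes x :: "bool word"
  assumes "x \<in> closure A"
  obtains y where "y \<in> A" "\<And>t. t < h \<Longrightarrow> y t = x t"
proof -
  have "open {y :: bool word. y t = x t}" for t by (rule open_coordinate)
  then have "open (\<Inter>t\<in>{..<h}. {y :: bool word. y t = x t})" by blast
  then have "(\<Inter>t\<in>{..<h}. {y. y t = x t}) \<inter> A \<noteq> {}"
    using assms open_Int_closure_eq_empty[of "\<Inter>t\<in>{..<h}. {y. y t = x t}" A] by blast
  then show thesis using that by blast
qed

text \<open>Each window involves finitely many coordinates, and a point of the closure shares any
  finite prefix with some point of \<open>A\<close>. That point may vary with the window.\<close>

lemma tame_closure:
  assumes "\<And>y. y \<in> A \<Longrightarrow> tame K y" "x \<in> closure A"
  shows "tame K x"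
  unfolding tame_def
proof (intro allI impI)
  fix i m assume *: "x i" "x (i + m)" "gaps_below K x i m"
  obtain y where y: "y \<in> A" "\<And>t. t < Suc (i + m) \<Longrightarrow> y t = x t"
    using closure_prefix[OF assms(2)] by blast
  have eq: "y (i + r) = x (i + r)" if "r \<le> m" for r using that y(2) by simp
  show "m < K * (2 ^ K + 1) \<or>
    (\<forall>r. r + fact (K * (2 ^ K + 1)) \<le> m \<longrightarrow> x (i + r + fact (K * (2 ^ K + 1))) = x (i + r))"
    by (rule tame_window[OF assms(1)[OF y(1)] eq *])
qed

section \<open>Sequences made of blocks from a lower level, separated by long runs of zeros\<close>

text \<open>
  The block containing the given 1 is recorded from this 1 onwards only, which makes the notion
  invariant under the shift.
\<close>

definition blocks_from :: "nat \<Rightarrow> bool word set \<Rightarrow> bool word \<Rightarrow> bool" where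
  "blocks_from K A x \<longleftrightarrow>
     (\<forall>t. x t \<longrightarrow> (\<exists>e>t. (\<exists>y\<in>A. \<exists>a. \<forall>r. t + r < e \<longrightarrow> y (a + r) = x (t + r)) \<and>
        (\<forall>r. e \<le> r \<longrightarrow> r < e + K \<longrightarrow> \<not> x r)))"

lemma blocks_fromE:
  assumes "blocks_from K A x" "x t"
  obtains e y a where "t < e" "y \<in> A" "\<forall>r. t + r < e \<longrightarrow> y (a + r) = x (t + r)"
    "\<forall>r. e \<le> r \<longrightarrow> r < e + K \<longrightarrow> \<not> x r"
proof -
  have "\<exists>e>t. (\<exists>y\<in>A. \<exists>a. \<forall>r. t + r < e \<longrightarrow> y (a + r) = x (t + r)) \<and>
      (\<forall>r. e \<le> r \<longrightarrow> r < e + K \<longrightarrow> \<not> x r)"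
    using assms(1)[unfolded blocks_from_def, rule_format, OF assms(2)] .
  then show thesis by (elim exE conjE bexE) (rule that)
qed

text \<open>A window with gaps below \<open>K\<close> cannot cross the \<open>K\<close> zeros after
  the block in which it starts. It is thus a copy of a window of a point of \<open>A\<close>, and
  tameness transfers.\<close>

lemma tame_blocks_from:
  assumes "blocks_from K A x" "\<And>y. y \<in> A \<Longrightarrow> tame K y"
  shows "tame K x"
  unfolding tame_def
proof (intro allI impI)
  fix i m assume *: "x i" "x (i + m)" "gaps_below K x i m"
  obtain e y a where e': "i < e" "y \<in> A" "\<forall>r. i + r < e \<longrightarrow> y (a + r) = x (i + r)"
    "\<forall>r. e \<le> r \<longrightarrow> r < e + K \<longrightarrow> \<not> x r"
    using blocks_fromE[OF assms(1) *(1)] .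
  note e = e'[rule_format]
  have "i + m < e"
  proof (rule ccontr)
    assume "\<not> i + m < e"
    \<comment> \<open>The 1 at \<open>i + m\<close> cannot lie in the run of zeros, so the whole run
      would fit inside the window.\<close>
    then have "e + K \<le> i + m" using e(4)[of "i + m"] *(2) by linarith
    then have "\<exists>s\<in>{e..<e + K}. x s"
      using *(3)[unfolded gaps_below_def, rule_format, of e] e(1) by simp
    then show False using e(4) by force
  qed
  then have eq: "y (a + r) = x (i + r)" if "r \<le> m" for r using that e(3) by simp
  show "m < K * (2 ^ K + 1) \<or>
    (\<forall>r. r + fact (K * (2 ^ K + 1)) \<le> m \<longrightarrow> x (i + r + fact (K * (2 ^ K + 1))) = x (i + r))"
    by (rule tame_window[OF assms(2)[OF e(2)] eq *])
qed

lemma conc_at_add: "(u \<frown> y) (length u + t) = y t"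
  by (simp add: conc_def)

text \<open>A 1 inside \<open>u\<close> has its block end at \<open>length u\<close>, where the
  initial zeros of \<open>y\<close> begin; for a later 1 the block end given by \<open>y\<close> is
  moved by \<open>length u\<close>.\<close>

lemma blocks_from_conc:
  assumes "blocks_from K A y" "\<And>r. r < K \<Longrightarrow> \<not> y r" "z \<in> A" "occurs_in u z"
  shows "blocks_from K A (u \<frown> y)"
  unfolding blocks_from_def
proof (intro allI impI)
  fix t assume t: "(u \<frown> y) t"
  show "\<exists>e>t. (\<exists>z\<in>A. \<exists>a. \<forall>r. t + r < e \<longrightarrow> z (a + r) = (u \<frown> y) (t + r)) \<and>
        (\<forall>r. e \<le> r \<longrightarrow> r < e + K \<longrightarrow> \<not> (u \<frown> y) r)"
  proof (cases "t < length u")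
    case True
    obtain i j where u: "u = subsequence z i j" using assms(4) unfolding occurs_in_def by blast
    have "z (i + t + r) = (u \<frown> y) (t + r)" if "t + r < length u" for r
      using that by (simp add: conc_def u add.assoc)
    moreover have "\<not> (u \<frown> y) r" if "length u \<le> r" "r < length u + K" for r
      using that assms(2)[of "r - length u"] by (simp add: conc_def)
    ultimately show ?thesis using True assms(3) by (intro exI[of _ "length u"]) blast
  next
    case False
    define t' where "t' = t - length u"
    have tt: "t = length u + t'" using False by (simp add: t'_def)
    have "y t'" using t tt by (simp add: conc_at_add)
    obtain e z' a where e': "t' < e" "z' \<in> A" "\<forall>r. t' + r < e \<longrightarrow> z' (a + r) = y (t' + r)"
      "\<forall>r. e \<le> r \<longrightarrow> r < e + K \<longrightarrow> \<not> y r"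
      using blocks_fromE[OF assms(1) \<open>y t'\<close>] .
    note e = e'[rule_format]
    have "z' (a + r) = (u \<frown> y) (t + r)" if "t + r < length u + e" for r
      using e(3)[of r] that by (simp add: tt add.assoc conc_at_add)
    moreover have "\<not> (u \<frown> y) r" if "length u + e \<le> r" "r < length u + e + K" for r
      using e(4)[of "r - length u"] that by (simp add: conc_def)
    ultimately show ?thesis using e(1,2) tt by (intro exI[of _ "length u + e"]) auto
  qed
qed

lemma zeros_at: "(zeros a \<frown> y) t \<longleftrightarrow> a \<le> t \<and> y (t - a)"
  by (simp add: conc_def zeros_def)

lemma blocks_from_zeros:
  assumes "blocks_from K A y"
  shows "blocks_from K A (zeros a \<frown> y)"
  unfolding blocks_from_def
proof (intro allI impI)
  fix t assume "(zeros a \<frown> y) t"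
  then have t: "a \<le> t" "y (t - a)" by (simp_all add: zeros_at)
  obtain e z b where e': "t - a < e" "z \<in> A"
      "\<forall>r. (t - a) + r < e \<longrightarrow> z (b + r) = y ((t - a) + r)"
      "\<forall>r. e \<le> r \<longrightarrow> r < e + K \<longrightarrow> \<not> y r"
    using blocks_fromE[OF assms t(2)] .
  note e = e'[rule_format]
  have "z (b + r) = (zeros a \<frown> y) (t + r)" if "t + r < a + e" for r
    using e(3)[of r] that t by (simp add: zeros_at)
  moreover have "\<not> (zeros a \<frown> y) r" if "a + e \<le> r" "r < a + e + K" for r
    using e(4)[of "r - a"] that by (simp add: zeros_at)
  ultimately show "\<exists>e>t. (\<exists>z\<in>A. \<exists>b. \<forall>r. t + r < e \<longrightarrow> z (b + r) = (zeros a \<frown> y) (t + r)) \<and>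
        (\<forall>r. e \<le> r \<longrightarrow> r < e + K \<longrightarrow> \<not> (zeros a \<frown> y) r)"
    using e(1,2) t by (intro exI[of _ "a + e"]) auto
qed

lemma not_zero_seq: "\<not> zero_seq t"
  by (simp add: zero_seq_def iter_def)

lemma blocks_from_zero_seq: "blocks_from K A zero_seq"
  by (simp add: blocks_from_def not_zero_seq)

text \<open>Each copy of \<open>u\<close> is a block of its own, since \<open>k\<close> zeros follow
  it.\<close>

lemma blocks_from_iter:
  assumes "z \<in> A" "occurs_in u z" "K \<le> k" "u \<noteq> []"
  shows "blocks_from K A ((u @ zeros k)\<^sup>\<omega>)"
  unfolding blocks_from_def
proof (intro allI impI)
  let ?x = "(u @ zeros k)\<^sup>\<omega>" and ?p = "length u + k"
  have x: "?x t \<longleftrightarrow> t mod ?p < length u \<and> u ! (t mod ?p)" for t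
  proof -
    have "t mod ?p < ?p" using assms(4) by simp
    moreover have "?x t = (u @ zeros k) ! (t mod ?p)"
      using assms(4) by (simp add: iter_def zeros_def)
    moreover have "\<not> zeros k ! c" if "c < k" for c using that by (simp add: zeros_def)
    ultimately show ?thesis by (simp add: nth_append)
  qed
  fix t assume t: "?x t"
  \<comment> \<open>\<open>q\<close> is the coordinate where the copy of \<open>u @ zeros k\<close>
    containing \<open>t\<close> starts, so the block ends at \<open>q + length u\<close>.\<close>
  define q where "q = t - t mod ?p"
  have "?p dvd q" by (simp add: q_def dvd_minus_mod)
  then have q: "(q + c) mod ?p = c" if "c < ?p" for c
    using that by (auto elim!: dvdE)
  have tq: "t = q + t mod ?p" by (simp add: q_def)
  have tu: "t mod ?p < length u" using t x by blast
  obtain i j where u: "u = subsequence z i j" using assms(2) unfolding occurs_in_def by blast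
  have nth: "u ! c = z (i + c)" if "c < length u" for c
    using that by (simp add: u)
  have "z (i + t mod ?p + r) = ?x (t + r)" if r: "t + r < q + length u" for r
  proof -
    have 1: "t mod ?p + r < length u" using r tq by linarith
    have "t + r = q + (t mod ?p + r)" using tq by linarith
    moreover have "(q + (t mod ?p + r)) mod ?p = t mod ?p + r" using 1 by (intro q) simp
    ultimately have "(t + r) mod ?p = t mod ?p + r" by (simp only:)
    then have "?x (t + r) \<longleftrightarrow> u ! (t mod ?p + r)" using 1 by (simp only: x simp_thms)
    also have "u ! (t mod ?p + r) = z (i + t mod ?p + r)"
      using nth[OF 1] by (simp only: add.assoc)
    finally show ?thesis by simp
  qed
  moreover have "\<not> ?x r" if r: "q + length u \<le> r" "r < q + length u + K" for r
  proof -
    \<comment> \<open>Since \<open>K <= k\<close>, the zeros considered end before the next copy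
      starts.\<close>
    have "r mod ?p = r - q" using q[of "r - q"] r assms(3) by simp
    then have "\<not> r mod ?p < length u" using r by linarith
    then show ?thesis unfolding x by blast
  qed
  moreover have "t < q + length u" using tq tu by linarith
  ultimately show "\<exists>e>t. (\<exists>y\<in>A. \<exists>a. \<forall>r. t + r < e \<longrightarrow> y (a + r) = ?x (t + r)) \<and>
        (\<forall>r. e \<le> r \<longrightarrow> r < e + K \<longrightarrow> \<not> ?x r)"
    using assms(1) by (intro exI[of _ "q + length u"]) blast
qed

lemma funpow_shift: "(\<sigma> ^^ l) x t = x (t + l)"
  by (induction l arbitrary: t) (simp_all add: shift_def)

lemma blocks_from_shift:
  assumes "blocks_from K A x"
  shows "blocks_from K A ((\<sigma> ^^ l) x)"
  unfolding blocks_from_def funpow_shift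
proof (intro allI impI)
  fix t assume t: "x (t + l)"
  obtain e z b where e': "t + l < e" "z \<in> A"
      "\<forall>r. t + l + r < e \<longrightarrow> z (b + r) = x (t + l + r)"
      "\<forall>r. e \<le> r \<longrightarrow> r < e + K \<longrightarrow> \<not> x r"
    using blocks_fromE[OF assms t] .
  note e = e'[rule_format]
  \<comment> \<open>The subtraction \<open>e - l\<close> is exact, because
    \<open>t + l < e\<close>.\<close>
  have "z (b + r) = x (t + r + l)" if "t + r < e - l" for r
    using e(3)[of r] that by (simp add: ac_simps)
  moreover have "\<not> x (r + l)" if "e - l \<le> r" "r < e - l + K" for r
    using e(4)[of "r + l"] that e(1) by simp
  ultimately show "\<exists>e>t. (\<exists>y\<in>A. \<exists>a. \<forall>r. t + r < e \<longrightarrow> y (a + r) = x (t + r + l)) \<and>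
        (\<forall>r. e \<le> r \<longrightarrow> r < e + K \<longrightarrow> \<not> x (r + l))"
    using e(1,2) by (intro exI[of _ "e - l"]) auto
qed

lemma G_nonempty: "u \<in> G m Y \<Longrightarrow> u \<noteq> []"
  by (auto simp: G_def from_1_to_1_def)

lemma le_four_power: "K \<le> n \<Longrightarrow> K \<le> 2 ^ (2 * n)"
proof -
  assume "K \<le> n"
  also have "n \<le> 2 ^ n" using less_exp[of n] by simp
  also have "(2::nat) ^ n \<le> 2 ^ (2 * n)" by (intro power_increasing) auto
  finally show ?thesis .
qed

text \<open>For \<open>n >= K\<close> the inserted runs have length at least
  \<open>2 ^ (2 * n) >= K\<close>, so the new points consist of blocks from level \<open>n\<close>
  and inherit tameness from there.\<close>

lemma tame_high_level:
  assumes "K \<le> n" "\<And>y. y \<in> A \<Longrightarrow> tame K y"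
    and "x \<in> P_next n A \<union> (J1_next n A \<union> J2_next n A)"
  shows "tame K x"
proof (rule tame_blocks_from[OF _ assms(2)])
  have Kn: "K \<le> 2 ^ (2 * n)" by (rule le_four_power[OF assms(1)])
  have block: "blocks_from K A (u \<frown> y)"
    if "u \<in> G (2 ^ n) A" "blocks_from K A y" "\<And>r. r < K \<Longrightarrow> \<not> y r" for u y
    using that blocks_from_conc unfolding G_def by blast
  consider l u k where "x = (\<sigma> ^^ l) ((u @ zeros k)\<^sup>\<omega>)" "k \<ge> 2 ^ (2 * n)" "u \<in> G (2 ^ n) A"
    | a u where "x = zeros a \<frown> u \<frown> zero_seq" "u \<in> G (2 ^ n) A"
    | a u b v where "x = zeros a \<frown> u \<frown> zeros b \<frown> v \<frown> zero_seq" "b \<ge> 2 ^ (2 * n)"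
        "u \<in> G (2 ^ n) A" "v \<in> G (2 ^ n) A"
    using assms(3) unfolding P_next_def J1_next_def J2_next_def by blast
  then show "blocks_from K A x"
  proof cases
    case 1
    then obtain z where "z \<in> A" "occurs_in u z" by (auto simp: G_def)
    then show ?thesis
      using 1 Kn G_nonempty[OF 1(3)]
      by (simp only:) (intro blocks_from_shift blocks_from_iter; simp)
  next
    case 2
    then show ?thesis
      by (simp only:) (intro blocks_from_zeros block blocks_from_zero_seq not_zero_seq)
  next
    case 3
    have tail: "blocks_from K A (zeros b \<frown> v \<frown> zero_seq)"
      using 3 by (intro blocks_from_zeros block blocks_from_zero_seq not_zero_seq)
    have "\<not> (zeros b \<frown> v \<frown> zero_seq) r" if "r < K" for r
      using that Kn 3(2) by (simp only: zeros_at) simp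
    then have "blocks_from K A (u \<frown> zeros b \<frown> v \<frown> zero_seq)"
      by (rule block[OF 3(3) tail])
    then show ?thesis
      unfolding 3(1) by (rule blocks_from_zeros)
  qed
qed

section \<open>Counting ones for the levels below K\<close>

text \<open>The window splits into \<open>q\<close> disjoint pieces of length \<open>K\<close>, each
  containing a 1.\<close>

lemma ones_ge:
  assumes "gaps_below K x i (K * q)"
  shows "q \<le> card {t \<in> {i..<i + K * q}. x t}"
  using assms
proof (induction q)
  case (Suc q)
  have "gaps_below K x i (K * q)"
    using Suc.prems unfolding gaps_below_def by simp
  then have IH: "q \<le> card {t \<in> {i..<i + K * q}. x t}" by (rule Suc.IH)
  have "\<exists>s\<in>{i + K * q..<i + K * q + K}. x s"
    using Suc.prems[unfolded gaps_below_def, rule_format, of "i + K * q"] by simp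
  then obtain s where s: "s \<in> {i + K * q..<i + K * q + K}" "x s" by blast
  have "Suc q \<le> card (insert s {t \<in> {i..<i + K * q}. x t})"
    using IH s by (subst card_insert_disjoint) auto
  also have "\<dots> \<le> card {t \<in> {i..<i + K * Suc q}. x t}"
    using s by (intro card_mono) auto
  finally show ?case .
qed simp

text \<open>Here the first alternative of tameness always holds: a longer window would contain an
  initial piece with at least \<open>2 ^ K + 1\<close> ones.\<close>

lemma tame_few_ones:
  assumes "\<And>i. card {t \<in> {i..<i + K * (2 ^ K + 1)}. x t} \<le> 2 ^ K"
  shows "tame K x"
  unfolding tame_def
proof (intro allI impI disjI1, rule ccontr)
  fix i m assume gaps: "gaps_below K x i m" and "\<not> m < K * (2 ^ K + 1)"
  then have "gaps_below K x i (K * (2 ^ K + 1))"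
    unfolding gaps_below_def by (meson le_trans add_le_cancel_left not_less)
  from ones_ge[OF this] assms[of i] show False by simp
qed

lemma card_ones_conc:
  assumes "finite {t. y t}"
  shows "finite {t. (u \<frown> y) t}" "card {t. (u \<frown> y) t} = num_ones u + card {t. y t}"
proof -
  have eq: "{t. (u \<frown> y) t} = {t. t < length u \<and> u ! t} \<union> (\<lambda>t. length u + t) ` {t. y t}"
    (is "_ = ?A \<union> ?B")
  proof (intro equalityI subsetI)
    fix t assume "t \<in> {t. (u \<frown> y) t}"
    then show "t \<in> ?A \<union> ?B"
      by (cases "t < length u")
        (auto simp: conc_def intro: image_eqI[of _ _ "t - length u"])
  qed (auto simp: conc_def)
  show "finite {t. (u \<frown> y) t}" using assms unfolding eq by auto
  have "card (?A \<union> ?B) = card ?A + card ?B" using assms by (intro card_Un_disjoint) auto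
  also have "card ?B = card {t. y t}" by (intro card_image) (auto simp: inj_on_def)
  also have "card ?A = num_ones u"
    by (simp add: num_ones_def count_list_eq_length_filter length_filter_conv_card)
  finally show "card {t. (u \<frown> y) t} = num_ones u + card {t. y t}" by (simp add: eq)
qed

lemma tame_finite_ones:
  assumes "finite {t. x t}" "card {t. x t} \<le> 2 ^ K"
  shows "tame K x"
proof (rule tame_few_ones)
  fix i
  have "card {t \<in> {i..<i + K * (2 ^ K + 1)}. x t} \<le> card {t. x t}"
    using assms(1) by (intro card_mono) auto
  then show "card {t \<in> {i..<i + K * (2 ^ K + 1)}. x t} \<le> 2 ^ K" using assms(2) by simp
qed

lemma ones_zero_seq: "{t. zero_seq t} = {}"
  by (simp add: not_zero_seq)

lemma num_ones_zeros: "num_ones (zeros a) = 0"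
  by (induction a) (simp_all add: num_ones_def zeros_def)

text \<open>A short period divides the factorial and gives the second alternative of tameness. With
  a long period, a window of the critical length fits into one period and sees each 1 of
  \<open>u\<close> at most once.\<close>

lemma tame_iter:
  assumes "u \<noteq> []" "num_ones u \<le> 2 ^ K"
  shows "tame K ((\<sigma> ^^ l) ((u @ zeros k)\<^sup>\<omega>))" (is "tame K ?y")
proof -
  let ?p = "length u + k" and ?B = "K * (2 ^ K + 1)"
  have p: "?p > 0" using assms(1) by simp
  have y: "?y t \<longleftrightarrow> (u @ zeros k) ! ((t + l) mod ?p)" for t
    using p assms(1) by (simp add: funpow_shift iter_def zeros_def)
  show ?thesis
  proof (cases "?p \<le> ?B")
    case True
    then have "?p dvd fact ?B" using p by (intro dvd_fact) linarith+
    then have "(t + fact ?B + l) mod ?p = (t + l) mod ?p" for t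
      by (metis add.assoc add.commute mod_add_right_eq dvd_imp_mod_0 add.right_neutral)
    then show ?thesis unfolding tame_def y by simp
  next
    case False
    show ?thesis
    proof (rule tame_few_ones)
      fix i
      let ?W = "{t \<in> {i..<i + ?B}. ?y t}"
      \<comment> \<open>Two positions of the window are less than one period apart, so they have
        different residues.\<close>
      have "inj_on (\<lambda>t. (t + l) mod ?p) ?W"
      proof (rule inj_onI)
        fix s t assume st: "s \<in> ?W" "t \<in> ?W" and eq: "(s + l) mod ?p = (t + l) mod ?p"
        show "s = t"
          using st eq False
        proof (induction s t rule: linorder_wlog)
          case (le s t)
          then have "?p dvd (t + l) - (s + l)" by (metis mod_eq_dvd_iff_nat add_le_mono1)
          then have "?p dvd t - s" by simp
          moreover have "t - s < ?p" using le by auto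
          ultimately show ?case using le(1) by (metis diff_is_0_eq nat_dvd_not_less le_antisym
            gr0I)
        next
          case (sym s t)
          then show ?case by metis
        qed
      qed
      moreover have "(\<lambda>t. (t + l) mod ?p) ` ?W \<subseteq> {r. r < length u \<and> u ! r}"
      proof
        fix r assume "r \<in> (\<lambda>t. (t + l) mod ?p) ` ?W"
        then have "(u @ zeros k) ! r" "r < ?p" using y p by auto
        then show "r \<in> {r. r < length u \<and> u ! r}"
          by (auto simp: nth_append zeros_def split: if_splits)
      qed
      ultimately have "card ?W \<le> card {r. r < length u \<and> u ! r}"
        by (intro card_inj_on_le) auto
      also have "\<dots> = num_ones u"
        by (simp add: num_ones_def count_list_eq_length_filter length_filter_conv_card)
      finally show "card ?W \<le> 2 ^ K" using assms(2) by simp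
    qed
  qed
qed

lemma tame_low_level:
  assumes "n < K" "x \<in> P_next n A \<union> (J1_next n A \<union> J2_next n A)"
  shows "tame K x"
proof -
  have le: "num_ones u \<le> 2 ^ n" if "u \<in> G (2 ^ n) A" for u
    using that by (simp add: G_def)
  \<comment> \<open>Points of \<open>J2_next\<close> contain two words with up to
    \<open>2 ^ n\<close> ones each; \<open>n < K\<close> leaves room for both.\<close>
  have nK: "(2::nat) ^ n + 2 ^ n \<le> 2 ^ K"
    using power_increasing[of "Suc n" K "2::nat"] assms(1) by simp
  consider l u k where "x = (\<sigma> ^^ l) ((u @ zeros k)\<^sup>\<omega>)" "u \<in> G (2 ^ n) A"
    | a u where "x = zeros a \<frown> u \<frown> zero_seq" "u \<in> G (2 ^ n) A"
    | a u b v where "x = zeros a \<frown> u \<frown> zeros b \<frown> v \<frown> zero_seq"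
        "u \<in> G (2 ^ n) A" "v \<in> G (2 ^ n) A"
    using assms(2) unfolding P_next_def J1_next_def J2_next_def by blast
  then show ?thesis
  proof cases
    case 1
    then show ?thesis using tame_iter[of u K l k] G_nonempty le[of u] nK by auto
  next
    case 2
    then show ?thesis using le[of u] nK
      by (simp only:) (intro tame_finite_ones;
        simp add: card_ones_conc ones_zero_seq num_ones_zeros del: conc_conc)
  next
    case 3
    then show ?thesis using le[of u] le[of v] nK
      by (simp only:) (intro tame_finite_ones;
        simp add: card_ones_conc ones_zero_seq num_ones_zeros del: conc_conc)
  qed
qed

text \<open>With \<open>K\<close> fixed, the levels built from \<open>n < K\<close> are tame by
  counting, and from \<open>n >= K\<close> on tameness is inherited.\<close>

lemma tame_X_level: "x \<in> X_level n \<Longrightarrow> tame K x"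
proof (induction n arbitrary: x)
  case 0
  then consider "x = zero_seq" | a where "x = zeros a \<frown> [True] \<frown> zero_seq"
    by (auto simp del: conc_conc)
  then show ?case
  proof cases
    case 1
    then show ?thesis by (simp add: tame_finite_ones ones_zero_seq)
  next
    case 2
    have "num_ones [True] = 1" by (simp add: num_ones_def)
    then show ?thesis unfolding 2
      by (intro tame_finite_ones;
        simp only: card_ones_conc ones_zero_seq num_ones_zeros finite.emptyI; simp)
  qed
next
  case (Suc n)
  have "tame K y" if "y \<in> P_next n (X_level n) \<union> (J1_next n (X_level n) \<union> J2_next n (X_level n))" for y
    using that tame_low_level[of n K y] tame_high_level[of K n "X_level n" y] Suc.IH
    by (meson not_le)
  then show ?case
    using Suc tame_closure unfolding X_level.simps Y_next_def by blast
qed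

lemma tame_X_space: "x \<in> X_space \<Longrightarrow> tame K x"
  unfolding X_space_def using tame_closure[of "\<Union>n. X_level n" K x] tame_X_level by blast

section \<open>Minimal sets are periodic orbits\<close>

lemma closed_singleton_word: "closed {y :: bool word}"
proof -
  have "closed {z :: bool word. z t = y t}" for t
    by (intro closed_Collect_eq continuous_on_product_coordinates continuous_on_const)
  then have "closed (\<Inter>t. {z. z t = y t})" by blast
  also have "(\<Inter>t. {z. z t = y t}) = {y}" by (auto simp: fun_eq_iff)
  finally show ?thesis .
qed

lemma periodic_orbit:
  assumes "x \<in> M" "\<sigma> ` M \<subseteq> M" "M \<subseteq> X" "L > 0" "\<And>r. x (r + L) = x r"
  shows "\<exists>N. finite N \<and> N \<subseteq> M \<and> closed_invariant X \<sigma> N"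
proof -
  define N where "N = (\<lambda>l. (\<sigma> ^^ l) x) ` {..<L}"
  have fin: "finite N" by (simp add: N_def)
  have "(\<sigma> ^^ l) x \<in> M" for l
    using assms(1,2) by (induction l) auto
  then have sub: "N \<subseteq> M" unfolding N_def by blast
  have 0: "(\<sigma> ^^ 0) x \<in> N" using assms(4) unfolding N_def by blast
  have "\<sigma> ((\<sigma> ^^ l) x) \<in> N" if "l < L" for l
  proof (cases "Suc l < L")
    case True
    then have "(\<sigma> ^^ Suc l) x \<in> N" unfolding N_def by blast
    then show ?thesis by simp
  next
    case False
    then have L: "Suc l = L" using that by simp
    have "\<sigma> ((\<sigma> ^^ l) x) = (\<sigma> ^^ Suc l) x" by simp
    also have "\<dots> = (\<sigma> ^^ 0) x"
      unfolding L by (rule ext) (simp only: funpow_shift assms(5) add_0_right)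
    finally show ?thesis using 0 by simp
  qed
  then have "\<sigma> ` N \<subseteq> N" unfolding N_def by blast
  moreover have "closed (\<Union>y\<in>N. {y})"
    using fin closed_singleton_word by (intro closed_UN) auto
  then have "closedin (top_of_set X) N" using sub assms(3) by (intro closed_subset) auto
  ultimately have "closed_invariant X \<sigma> N" using 0 unfolding closed_invariant_def by blast
  then show ?thesis using fin sub by blast
qed

text \<open>The open sets of points with a 1 at \<open>t\<close> cover \<open>M\<close>. A finite
  subcover bounds the first 1 of all points of \<open>M\<close>, and applying this to the shifted
  points bounds every gap.\<close>

lemma bounded_gaps:
  assumes "compact M" "\<sigma> ` M \<subseteq> M" "zero_seq \<notin> M"
  shows "\<exists>K. \<forall>x\<in>M. \<forall>r. \<exists>s\<in>{r..<r + K}. x s"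
proof -
  have "M \<subseteq> (\<Union>t. {x. x t = True})"
  proof
    fix x assume "x \<in> M"
    then have "x \<noteq> zero_seq" using assms(3) by metis
    then obtain t where "x t \<noteq> zero_seq t" unfolding fun_eq_iff by blast
    then show "x \<in> (\<Union>t. {x. x t = True})" by (auto simp: not_zero_seq)
  qed
  then obtain F where F: "finite F" "M \<subseteq> (\<Union>t\<in>F. {x. x t = True})"
    by (rule compactE_image[OF assms(1) open_coordinate])
  obtain K where K: "F \<subseteq> {..<K}"
    using finite_nat_bounded[OF F(1)] by blast
  have "\<exists>s\<in>{r..<r + K}. x s" if "x \<in> M" for x r
  proof -
    have "(\<sigma> ^^ r) x \<in> M" using that assms(2) by (induction r) auto
    then obtain t where "t \<in> F" "(\<sigma> ^^ r) x t" using F(2) by blast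
    then show ?thesis
      using K by (intro bexI[of _ "t + r"]) (auto simp: funpow_shift)
  qed
  then show ?thesis by blast
qed

lemma tame_periodic:
  assumes "tame K x" "x 0" "\<And>r. \<exists>s\<in>{r..<r + K}. x s"
  shows "x (r + fact (K * (2 ^ K + 1))) = x r"
proof -
  define B where "B = K * (2 ^ K + 1)"
  define L :: nat where "L = fact B"
  \<comment> \<open>\<open>m >= B\<close> excludes the first alternative of tameness, and
    \<open>m >= r + L\<close> brings \<open>r\<close> into the range of the second.\<close>
  obtain m where m: "m \<ge> B + r + L" "x m"
    using assms(3)[of "B + r + L"] by auto
  have "gaps_below K x 0 m" using assms(3) by (simp add: gaps_below_def)
  then have "m < B \<or> (\<forall>r. r + L \<le> m \<longrightarrow> x (0 + r + L) = x (0 + r))"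
    using assms(1)[unfolded tame_def, rule_format, of 0 m] assms(2) m(2)
    unfolding B_def L_def by (simp only: add_0)
  then show ?thesis using m(1) unfolding B_def[symmetric] L_def[symmetric] by simp
qed

text \<open>\<open>M\<close> contains a periodic point, whose finite orbit is closed and invariant
  and hence, by minimality, all of \<open>M\<close>.\<close>

lemma minimal_set_finite:
  assumes M: "minimal_set X_space \<sigma> M"
  shows "finite M"
proof -
  have ci: "M \<noteq> {}" "closedin (top_of_set X_space) M" "\<sigma> ` M \<subseteq> M"
    using M unfolding minimal_set_def closed_invariant_def by meson+
  have sub: "M \<subseteq> X_space" using closedin_imp_subset[OF ci(2)] .
  have "\<exists>x\<in>M. \<exists>L>0. \<forall>r. x (r + L) = x r"
  proof (cases "zero_seq \<in> M")
    case True
    \<comment> \<open>The zero sequence is constant, so any positive number is a period.\<close>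
    then show ?thesis using not_zero_seq by blast
  next
    case False
    obtain K where K: "\<And>x r. x \<in> M \<Longrightarrow> \<exists>s\<in>{r..<r + K}. x s"
      using bounded_gaps[OF closedin_compact[OF compact_X_space ci(2)] ci(3) False] by blast
    \<comment> \<open>Tameness speaks of windows starting at a 1, so a point of \<open>M\<close> is
      shifted until it starts with one.\<close>
    obtain y i where y: "y \<in> M" "y i" using ci(1) K by blast
    define x where "x = (\<sigma> ^^ i) y"
    have "(\<sigma> ^^ l) y \<in> M" for l using y(1) ci(3) by (induction l) auto
    then have x: "x \<in> M" unfolding x_def .
    have "x 0" using y(2) by (simp add: x_def funpow_shift)
    then have "x (r + fact (K * (2 ^ K + 1))) = x r" for r
      using tame_periodic[OF tame_X_space _ K[OF x]] x sub by blast
    then show ?thesis using x fact_gt_zero by blast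
  qed
  then obtain N where N: "finite N" "N \<subseteq> M" "closed_invariant X_space \<sigma> N"
    using periodic_orbit[OF _ ci(3) sub] by metis
  have "\<not> N \<subset> M" using M N(3) unfolding minimal_set_def by blast
  then show ?thesis using N by blast
qed

theorem lemma12:
  shows "\<not> omega_star_chaotic X_space \<sigma>"
proof
  assume "omega_star_chaotic X_space \<sigma>"
  then obtain S where S: "uncountable S"
    and M: "\<forall>x\<in>S. \<forall>y\<in>S. x \<noteq> y \<longrightarrow>
        (\<exists>M. minimal_set X_space \<sigma> M \<and> infinite M \<and> M \<subseteq> omega_limit \<sigma> x - omega_limit \<sigma> y) \<and>
        omega_limit \<sigma> x \<inter> omega_limit \<sigma> y \<noteq> {}"
    unfolding omega_star_chaotic_def by (elim exE conjE) (rule that)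
  obtain x where x: "x \<in> S" using S by fastforce
  \<comment> \<open>Two distinct points of \<open>S\<close> provide an infinite minimal set, which
    contradicts finiteness.\<close>
  have "S \<noteq> {x}" using S by auto
  then obtain y where y: "y \<in> S" "x \<noteq> y" using x by blast
  obtain N where "minimal_set X_space \<sigma> N" "infinite N"
    using M[rule_format, OF x y] by (elim conjE exE) (rule that)
  then show False using minimal_set_finite by simp
qed

end
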